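(* Let $H=(V,E)$ be a connected hypergraph with sink $q$ and nonsink vertices $[n]$, and let $\vec{c}\in\mathbb{Z}_{\ge 0}^n$ be a configuration on the nonsink vertices of $H$. Then $\vec{c}$ is an $H$-parking function for $H$ if and only if $\vec{c}_B$ is a $G$-parking function for the bipartite incidence graph $B(H)$ with sink $q$.
   Context: A hypergraph $H=(V,E)$ consists of a finite vertex set $V$ and a set $E$ of nonempty subsets of $V$, called hyperedges. $H$ is connected if for any two vertices $v_1,v_2$ there is a sequence of hyperedges $(e_1,\dots,e_m)$ with $v_1\in e_1$, $v_2\in e_m$ and $e_i\cap e_{i+1}\neq\emptyset$ for all $i<m$. One vertex $q\in V$ is fixed as the sink, the others being identified with $[n]=\{1,\dots,n\}$. For nonempty $T\subseteq V$ and $v\in T$, set $\deg_T(v)=|\{e\in E: v\in e \text{ and } e\not\subseteq T\}|$. An $H$-parking function is a vector $\vec{c}\in\mathbb{Z}_{\ge 0}^n$ such that for every nonempty $T\subseteq[n]$ there is $i\in T$ with $c_i<\deg_T(i)$. The bipartite incidence graph $B(H)$ is the undirected graph with vertex set $E\sqcup V$ and an edge between $e\in E$ and $v\in V$ whenever $v\in e$; its sink is $q\in V$. Given $\vec{c}$ on $V\setminus q$, $\vec{c}_B$ is the configuration on the nonsink vertices of $B(H)$ that equals $\vec{c}$ on $V\setminus q$ and is $0$ on every vertex of $E$. For an undirected graph $G$ with a sink, a $G$-parking function is a vector $b$ of nonnegative integers indexed by the nonsink vertices such that for every nonempty set $S$ of nonsink vertices there is $j\in S$ such that the number of edges from $j$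 to vertices outside $S$ is greater than $b_j$. *)

theory Defs
  imports "Graph_Theory.Graph_Theory"
begin

section \<open>Hypergraphs\<close>

locale hypergraph =
  fixes V :: "'v set" and E :: "'v set set"
  assumes finite_V: "finite V"
    and hyperedge_subset: "e \<in> E \<Longrightarrow> e \<subseteq> V"
    and hyperedge_nonempty: "e \<in> E \<Longrightarrow> e \<noteq> {}"

text \<open>The two vertices are required to be distinct, so that a single vertex without hyperedges
  is connected.\<close>

definition hypergraph_connected :: "'v set \<Rightarrow> 'v set set \<Rightarrow> bool" where
  "hypergraph_connected V E \<longleftrightarrow>
     (\<forall>v1 \<in> V. \<forall>v2 \<in> V. v1 \<noteq> v2 \<longrightarrow>
        (\<exists>es. es \<noteq> [] \<and> set es \<subseteq> E \<and> v1 \<in> hd es \<and> v2 \<in> last es \<and>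
           (\<forall>i. Suc i < length es \<longrightarrow> es ! i \<inter> es ! Suc i \<noteq> {})))"

locale connected_hypergraph = hypergraph +
  assumes connected: "hypergraph_connected V E"


section \<open>Parking functions\<close>

definition hdeg :: "'v set set \<Rightarrow> 'v set \<Rightarrow> 'v \<Rightarrow> nat" where
  "hdeg E T v = card {e \<in> E. v \<in> e \<and> \<not> e \<subseteq> T}"

text \<open>The nonsink vertices are the elements of \<open>V - {q}\<close> themselves instead of numbers
  \<open>1, \<dots>, n\<close>. A configuration is a function on the whole vertex type; both notions of parking
  function only inspect its values on nonsink vertices.\<close>

definition hypergraph_parking :: "'v set \<Rightarrow> 'v set set \<Rightarrow> 'v \<Rightarrow> ('v \<Rightarrow> nat) \<Rightarrow> bool" where
  "hypergraph_parking V E q c \<longleftrightarrow>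
     (\<forall>T. T \<noteq> {} \<and> T \<subseteq> V - {q} \<longrightarrow> (\<exists>i \<in> T. c i < hdeg E T i))"

text \<open>An undirected graph is a symmetric digraph, as in \<^locale>\<open>pseudo_graph\<close>. Each edge between
  \<open>j\<close> and a vertex outside \<open>S\<close> then contributes exactly one arc leaving \<open>j\<close>.\<close>

definition graph_parking :: "('a, 'b) pre_digraph \<Rightarrow> 'a \<Rightarrow> ('a \<Rightarrow> nat) \<Rightarrow> bool" where
  "graph_parking G s b \<longleftrightarrow>
     (\<forall>S. S \<noteq> {} \<and> S \<subseteq> verts G - {s} \<longrightarrow>
        (\<exists>j \<in> S. card {a \<in> out_arcs G j. head G a \<notin> S} > b j))"


section \<open>The bipartite incidence graph\<close>

definition incidence_graph :: "'v set \<Rightarrow> 'v set set \<Rightarrow> ('v set + 'v) pair_pre_digraph" where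
  "incidence_graph V E =
     \<lparr> pverts = E <+> V,
       parcs = {(Inl e, Inr v) | e v. e \<in> E \<and> v \<in> V \<and> v \<in> e} \<union>
               {(Inr v, Inl e) | e v. e \<in> E \<and> v \<in> V \<and> v \<in> e} \<rparr>"

definition config_B :: "('v \<Rightarrow> nat) \<Rightarrow> 'v set + 'v \<Rightarrow> nat" where
  "config_B c = case_sum (\<lambda>_. 0) c"

lemma (in hypergraph) pair_graph_incidence_graph: "pair_graph (incidence_graph V E)"
proof -
  let ?G = "incidence_graph V E"
  have "finite E"
    using finite_V hyperedge_subset by (intro finite_subset[of E "Pow V"]) auto
  then have fin: "finite (pverts ?G)"
    using finite_V by (simp add: incidence_graph_def)
  have "parcs ?G \<subseteq> pverts ?G \<times> pverts ?G"
    by (auto simp: incidence_graph_def)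
  then have "finite (parcs ?G)"
    using fin finite_subset by blast
  then show ?thesis
    using fin
    by unfold_locales (auto simp: incidence_graph_def symmetric_def sym_def)
qed

end

theory Submission
  imports Defs
begin

text \<open>In the incidence graph, a hyperedge \<open>e\<close> carries the value \<open>0\<close>, so in a vertex set \<open>S\<close> it
  witnesses the parking condition as soon as one vertex of \<open>e\<close> is missing from \<open>S\<close>. The parking
  condition therefore only has content for sets \<open>S\<close> whose hyperedges all lie inside the vertex part
  \<open>T\<close> of \<open>S\<close>. Then every hyperedge not contained in \<open>T\<close> is missing from \<open>S\<close>, so a vertex \<open>v\<close> of
  \<open>T\<close> has at least \<^term>\<open>hdeg E T v\<close> edges leaving \<open>S\<close>, and a witness for \<open>T\<close> in the hypergraph is
  also one for \<open>S\<close>.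

  Conversely, among these sets with a given vertex part \<open>T\<close>, the largest consists of \<open>T\<close> and all the
  hyperedges inside \<open>T\<close>. For it the two degrees agree and no hyperedge can be a witness, so a witness
  in the graph is one for \<open>T\<close> in the hypergraph.\<close>

context hypergraph
begin

lemma finite_E: "finite E"
  using finite_V hyperedge_subset by (intro finite_subset[of E "Pow V"]) auto

lemma card_incidence_arcs_leaving_vertex:
  assumes "v \<in> V"
  shows "card {a \<in> out_arcs (with_proj (incidence_graph V E)) (Inr v).
                 head (with_proj (incidence_graph V E)) a \<notin> S}
       = card {e \<in> E. v \<in> e \<and> Inl e \<notin> S}"
proof -
  have "{a \<in> out_arcs (with_proj (incidence_graph V E)) (Inr v).
           head (with_proj (incidence_graph V E)) a \<notin> S}
      = (\<lambda>e. (Inr v, Inl e)) ` {e \<in> E. v \<in> e \<and> Inl e \<notin> S}"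
    using assms by (auto simp: out_arcs_def incidence_graph_def)
  then show ?thesis
    by (simp add: card_image inj_on_def)
qed

lemma card_incidence_arcs_leaving_hyperedge:
  assumes "e \<in> E"
  shows "card {a \<in> out_arcs (with_proj (incidence_graph V E)) (Inl e).
                 head (with_proj (incidence_graph V E)) a \<notin> S}
       = card {v \<in> e. Inr v \<notin> S}"
proof -
  have "{a \<in> out_arcs (with_proj (incidence_graph V E)) (Inl e).
           head (with_proj (incidence_graph V E)) a \<notin> S}
      = (\<lambda>v. (Inl e, Inr v)) ` {v \<in> e. Inr v \<notin> S}"
    using assms hyperedge_subset by (auto simp: out_arcs_def incidence_graph_def)
  then show ?thesis
    by (simp add: card_image inj_on_def)
qed

text \<open>With the arcs counted, the graph condition asks each \<open>S\<close> for a hyperedge that sticks out of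
  it or for a vertex incident to enough hyperedges missing from it.\<close>

lemma graph_parking_incidence_graph_iff:
  "graph_parking (with_proj (incidence_graph V E)) (Inr q) (config_B c) \<longleftrightarrow>
     (\<forall>S. S \<noteq> {} \<and> S \<subseteq> (E <+> V) - {Inr q} \<longrightarrow>
        (\<exists>e. Inl e \<in> S \<and> \<not> e \<subseteq> Inr -` S) \<or>
        (\<exists>v. Inr v \<in> S \<and> c v < card {e \<in> E. v \<in> e \<and> Inl e \<notin> S}))"
proof -
  let ?G = "with_proj (incidence_graph V E)"
  have witness_iff:
    "(\<exists>j \<in> S. card {a \<in> out_arcs ?G j. head ?G a \<notin> S} > config_B c j) \<longleftrightarrow>
       (\<exists>e. Inl e \<in> S \<and> \<not> e \<subseteq> Inr -` S) \<or>
       (\<exists>v. Inr v \<in> S \<and> c v < card {e \<in> E. v \<in> e \<and> Inl e \<notin> S})"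
    if "S \<subseteq> (E <+> V) - {Inr q}" for S
  proof -
    have hyperedge:
      "card {a \<in> out_arcs ?G (Inl e). head ?G a \<notin> S} > config_B c (Inl e) \<longleftrightarrow> \<not> e \<subseteq> Inr -` S"
      if "Inl e \<in> S" for e
    proof -
      have "e \<in> E"
        using that \<open>S \<subseteq> _\<close> by auto
      moreover have "finite e"
        using \<open>e \<in> E\<close> finite_V hyperedge_subset finite_subset by blast
      ultimately show ?thesis
        unfolding card_incidence_arcs_leaving_hyperedge[OF \<open>e \<in> E\<close>]
        by (auto simp: config_B_def card_gt_0_iff)
    qed
    have vertex:
      "card {a \<in> out_arcs ?G (Inr v). head ?G a \<notin> S} > config_B c (Inr v) \<longleftrightarrow>
         c v < card {e \<in> E. v \<in> e \<and> Inl e \<notin> S}"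
      if "Inr v \<in> S" for v
    proof -
      have "v \<in> V"
        using that \<open>S \<subseteq> _\<close> by auto
      show ?thesis
        unfolding card_incidence_arcs_leaving_vertex[OF \<open>v \<in> V\<close>]
        by (simp add: config_B_def)
    qed
    have "(\<exists>j \<in> S. P j) \<longleftrightarrow> (\<exists>e. Inl e \<in> S \<and> P (Inl e)) \<or> (\<exists>v. Inr v \<in> S \<and> P (Inr v))" for P
      unfolding Bex_def split_sum_ex ..
    then show ?thesis
      by (simp only: hyperedge vertex cong: conj_cong)
  qed
  have "verts ?G = E <+> V"
    by (simp add: incidence_graph_def)
  then show ?thesis
    unfolding graph_parking_def by (simp only: witness_iff cong: imp_cong conj_cong)
qed

lemma graph_parking_if_hypergraph_parking:
  assumes "hypergraph_parking V E q c"
  shows "graph_parking (with_proj (incidence_graph V E)) (Inr q) (config_B c)"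
  unfolding graph_parking_incidence_graph_iff
proof (intro allI impI)
  fix S :: "('v set + 'v) set"
  assume S: "S \<noteq> {} \<and> S \<subseteq> (E <+> V) - {Inr q}"
  define T where "T = (Inr -` S :: 'v set)"
  show "(\<exists>e. Inl e \<in> S \<and> \<not> e \<subseteq> Inr -` S) \<or>
        (\<exists>v. Inr v \<in> S \<and> c v < card {e \<in> E. v \<in> e \<and> Inl e \<notin> S})"
  proof (cases "\<exists>e. Inl e \<in> S \<and> \<not> e \<subseteq> T")
    case True
    then show ?thesis
      by (simp add: T_def)
  next
    case False
    \<comment> \<open>If \<open>T\<close> were empty, then any element of \<open>S\<close> would be a hyperedge contained in \<open>T\<close>,
      hence empty.\<close>
    have "T \<noteq> {}"
    proof
      assume "T = {}"
      obtain x where "x \<in> S"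
        using S by blast
      then obtain e where "Inl e \<in> S"
        using \<open>T = {}\<close> by (cases x) (auto simp: T_def)
      then have "e \<in> E" "e \<subseteq> T"
        using S False by auto
      then show False
        using \<open>T = {}\<close> hyperedge_nonempty by blast
    qed
    moreover have "T \<subseteq> V - {q}"
      using S by (auto simp: T_def)
    ultimately obtain v where v: "v \<in> T" "c v < hdeg E T v"
      using assms by (auto simp: hypergraph_parking_def)
    have "hdeg E T v \<le> card {e \<in> E. v \<in> e \<and> Inl e \<notin> S}"
      unfolding hdeg_def using False finite_E by (intro card_mono) auto
    with v show ?thesis
      by (auto simp: T_def)
  qed
qed

lemma hypergraph_parking_if_graph_parking:
  assumes "graph_parking (with_proj (incidence_graph V E)) (Inr q) (config_B c)"
  shows "hypergraph_parking V E q c"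
  unfolding hypergraph_parking_def
proof (intro allI impI)
  fix T assume T: "T \<noteq> {} \<and> T \<subseteq> V - {q}"
  define S where "S = {e \<in> E. e \<subseteq> T} <+> T"
  have "S \<noteq> {}" "S \<subseteq> (E <+> V) - {Inr q}"
    using T by (auto simp: S_def)
  moreover have "\<not> (\<exists>e. Inl e \<in> S \<and> \<not> e \<subseteq> Inr -` S)"
    by (auto simp: S_def)
  ultimately obtain v where v: "Inr v \<in> S" "c v < card {e \<in> E. v \<in> e \<and> Inl e \<notin> S}"
    using assms unfolding graph_parking_incidence_graph_iff by blast
  have "{e \<in> E. v \<in> e \<and> Inl e \<notin> S} = {e \<in> E. v \<in> e \<and> \<not> e \<subseteq> T}"
    by (auto simp: S_def)
  with v have "v \<in> T" "c v < hdeg E T v"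
    by (auto simp: S_def hdeg_def)
  then show "\<exists>i \<in> T. c i < hdeg E T i"
    by blast
qed

end

theorem proposition3p4:
  fixes V :: "'v set" and E :: "'v set set" and q :: 'v and c :: "'v \<Rightarrow> nat"
  assumes "connected_hypergraph V E" and "q \<in> V"
  shows "hypergraph_parking V E q c \<longleftrightarrow>
         graph_parking (with_proj (incidence_graph V E)) (Inr q) (config_B c)"
proof -
  interpret connected_hypergraph V E
    by fact
  show ?thesis
    using graph_parking_if_hypergraph_parking hypergraph_parking_if_graph_parking by blast
qed

end
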